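(* Let $\alpha_j\in(-\tfrac12\pi,\tfrac12\pi)$, where $j=1,2,\dots,n$. Then there exists a unique $\gamma\in(-\tfrac12\pi,\tfrac12\pi)$ such that $$\psi_{\alpha_n}\circ\cdots\circ\psi_{\alpha_2}\circ\psi_{\alpha_1}=\psi_\gamma .$$ In particular, if $P\in T$, $P_0=P$ and $P_j=\psi_{\alpha_j}(P_{j-1})$ for $j=1,\dots,n$, then the segment $PP_n$ remains tangent to the circle $C_a$, where $a=g(\gamma)$, as $P$ moves on the circle $T$.
   Context: $T$ is the unit circle in $\mathbb C=\mathbb R^2$. A circle $C_1$ lies entirely inside $T$, with its center on the radius between $(-1,0)$ and $(0,0)$. The two circles determine a pencil of coaxal circles with limit point $L=\frac{k'-1}{k'+1}$ inside $C_1$, where $0<k'<1$, and $k=\sqrt{1-k'^2}\in(0,1)$. Let $g(\theta)=g(\theta;k)=\int_0^\theta \frac{dt}{\sqrt{1-k^2\sin^2 t}}$ for $\theta\in\mathbb R$, $K=g(\pi/2)$, $\mathrm{am}=g^{-1}:\mathbb R\to\mathbb R$, $\mathrm{sn}\,u=\sin(\mathrm{am}\,u)$, $\mathrm{cn}\,u=\cos(\mathrm{am}\,u)$, $\mathrm{dn}\,u=\sqrt{1-k^2\,\mathrm{sn}^2u}$. For $\alpha\in\mathbb R$ the map $\psi_\alpha:T\to T$ is defined as follows: for $z=e^{2i\theta}\in T$ ($\theta\in\mathbb R$), put $u=g(\theta)$, $a=g(\alpha)$, $\theta'=\mathrm{am}(u+a)$, and $\psi_\alpha(z)=e^{2i\theta'}$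 (independent of the choice of $\theta$). For $a\in(-K,K]$, $C_a$ is the circle of the pencil with center $\left(\frac{\mathrm{dn}\,a-1}{\mathrm{dn}\,a+1},0\right)$ and radius $\frac{2\,\mathrm{cn}\,a}{1+\mathrm{dn}\,a}$, positively oriented if $a$ is positive and negatively oriented if $a$ is negative; $C_0$ is $T$ (with no orientation attached) and $C_K$ is the point circle $L$.
   Formalization: γ is taken in (-π/2, π/2] instead of the open interval: for n=2, α_1=α_2=am(K/2) the composite is ψ_{π/2}, which no γ in the open interval gives; in that case C_a is the point circle L. *)

theory Defs
  imports "HOL-Analysis.Analysis"
begin

definition ell_g :: "real \<Rightarrow> real \<Rightarrow> real" where
  "ell_g k \<theta> = (LBINT t=ereal 0..ereal \<theta>. 1 / sqrt (1 - k\<^sup>2 * (sin t)\<^sup>2))"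

definition ell_K :: "real \<Rightarrow> real" where
  "ell_K k = ell_g k (pi / 2)"

definition am :: "real \<Rightarrow> real \<Rightarrow> real" where
  "am k = inv (ell_g k)"

definition sn :: "real \<Rightarrow> real \<Rightarrow> real" where
  "sn k u = sin (am k u)"

definition cn :: "real \<Rightarrow> real \<Rightarrow> real" where
  "cn k u = cos (am k u)"

definition dn :: "real \<Rightarrow> real \<Rightarrow> real" where
  "dn k u = sqrt (1 - k\<^sup>2 * (sn k u)\<^sup>2)"

abbreviation unit_circle :: "complex set" where
  "unit_circle \<equiv> sphere 0 1"

text \<open>The choice of \<open>\<theta>\<close> with \<open>z = exp (2 i \<theta>)\<close> is immaterial: it is determined up to multiples
  of \<open>\<pi>\<close>, and \<open>ell_g k (\<theta> + \<pi>) = ell_g k \<theta> + 2 K\<close>. Only values on the unit circle are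
  meaningful.\<close>

definition psi :: "real \<Rightarrow> real \<Rightarrow> complex \<Rightarrow> complex" where
  "psi k \<alpha> z =
     (let \<theta> = (SOME \<theta>. z = cis (2 * \<theta>)); u = ell_g k \<theta>; a = ell_g k \<alpha>
      in cis (2 * am k (u + a)))"

primrec psi_comp :: "real \<Rightarrow> (nat \<Rightarrow> real) \<Rightarrow> nat \<Rightarrow> complex \<Rightarrow> complex" where
  "psi_comp k \<alpha> 0 = id"
| "psi_comp k \<alpha> (Suc n) = psi k (\<alpha> (Suc n)) \<circ> psi_comp k \<alpha> n"

datatype orientation = Positive | Negative | Unoriented

datatype oriented_circle =
  Oriented_Circle (circ_center: complex) (circ_radius: real) (circ_orientation: orientation)

text \<open>Meant for \<open>a \<in> (-K, K]\<close>. For \<open>a = 0\<close> the formulas give the unit circle, for \<open>a = K\<close> (where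
  \<open>cn = 0\<close> and \<open>dn = k'\<close>) the point circle at the limit point \<open>(k' - 1) / (k' + 1)\<close>.\<close>

definition pencil_circle :: "real \<Rightarrow> real \<Rightarrow> oriented_circle" where
  "pencil_circle k a =
     Oriented_Circle
       (complex_of_real ((dn k a - 1) / (dn k a + 1)))
       (2 * cn k a / (1 + dn k a))
       (if a = 0 \<or> a = ell_K k then Unoriented else if 0 < a then Positive else Negative)"

text \<open>These circles are coaxal with the unit circle and the limit point: the power of a point
  with respect to each of them is an affine combination of the powers with respect to the unit
  circle and the point circle.\<close>

lemma pencil_circle_coaxal:
  fixes k k' a :: real
  assumes "0 < k'" "k' < 1" "k = sqrt (1 - k'\<^sup>2)"
  shows "\<exists>\<mu>. \<forall>z. (dist z (circ_center (pencil_circle k a)))\<^sup>2 - (circ_radius (pencil_circle k a))\<^sup>2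
           = (1 - \<mu>) * ((cmod z)\<^sup>2 - 1)
             + \<mu> * (dist z (complex_of_real ((k' - 1) / (k' + 1))))\<^sup>2"
proof -
  define s where "s = sn k a"
  define d where "d = dn k a"
  define c where "c = cn k a"
  define L where "L = (k' - 1) / (k' + 1)"
  define e where "e = (d - 1) / (d + 1)"
  define r where "r = 2 * c / (1 + d)"
  have k2: "k\<^sup>2 = 1 - k'\<^sup>2" using assms by (simp add: power_le_one)
  have k'2: "k'\<^sup>2 < 1" using assms by (simp add: power_less_one_iff)
  have sc: "s\<^sup>2 + c\<^sup>2 = 1" by (simp add: s_def c_def sn_def cn_def)
  have "(1 - k'\<^sup>2) * s\<^sup>2 \<le> 1 * 1"
  proof (rule mult_mono)
    show "1 - k'\<^sup>2 \<le> 1" by simp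
    show "s\<^sup>2 \<le> 1" using sc zero_le_power2[of c] by linarith
  qed simp_all
  hence d2: "d\<^sup>2 = 1 - (1 - k'\<^sup>2) * s\<^sup>2" and d0: "d \<ge> 0"
    by (simp_all add: d_def dn_def s_def[symmetric] k2)
  have L0: "L \<noteq> 0" using assms by (simp add: L_def)
  have c2: "(1 - k'\<^sup>2) * c\<^sup>2 = d\<^sup>2 - k'\<^sup>2"
  proof -
    have c: "c\<^sup>2 = 1 - s\<^sup>2" using sc by simp
    show ?thesis unfolding d2 c by (simp add: algebra_simps)
  qed
  have eq: "(e\<^sup>2 - r\<^sup>2 + 1) * L = e * (L\<^sup>2 + 1)"
  proof -
    have nz: "d + 1 \<noteq> 0" "1 + d \<noteq> 0" "k' + 1 \<noteq> 0" using d0 assms by auto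
    have ed: "e * (d + 1) = d - 1" and rd: "r * (d + 1) = 2 * c" and Lk: "L * (k' + 1) = k' - 1"
      using nz by (simp_all add: e_def r_def L_def add.commute)
    have "((e\<^sup>2 - r\<^sup>2 + 1) * L) * ((d + 1)\<^sup>2 * (k' + 1)\<^sup>2)
        = ((e * (d + 1))\<^sup>2 - (r * (d + 1))\<^sup>2 + (d + 1)\<^sup>2) * ((L * (k' + 1)) * (k' + 1))"
      by (simp add: power2_eq_square algebra_simps)
    also have "\<dots> = ((d - 1)\<^sup>2 + (d + 1)\<^sup>2) * (k'\<^sup>2 - 1) + 4 * ((1 - k'\<^sup>2) * c\<^sup>2)"
      unfolding ed rd Lk by (simp add: power2_eq_square algebra_simps)
    also have "\<dots> = ((d - 1) * (d + 1)) * ((k' - 1)\<^sup>2 + (k' + 1)\<^sup>2)"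
      unfolding c2 by (simp add: power2_eq_square algebra_simps)
    also have "\<dots> = (e * (L\<^sup>2 + 1)) * ((d + 1)\<^sup>2 * (k' + 1)\<^sup>2)"
      unfolding ed[symmetric] Lk[symmetric] by (simp add: power2_eq_square algebra_simps)
    finally show ?thesis using nz by simp
  qed
  have power: "(dist z (complex_of_real x))\<^sup>2 = (cmod z)\<^sup>2 - 2 * x * Re z + x\<^sup>2" for z x
    unfolding dist_norm cmod_power2 by (simp add: power2_eq_square algebra_simps)
  have "(dist z (complex_of_real e))\<^sup>2 - r\<^sup>2
      = (1 - e / L) * ((cmod z)\<^sup>2 - 1) + e / L * (dist z (complex_of_real L))\<^sup>2" for z
  proof -
    have "e\<^sup>2 - r\<^sup>2 + 1 = e / L * (L\<^sup>2 + 1)" using eq L0 by (simp add: field_simps)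
    moreover have "e / L * L = e" using L0 by simp
    ultimately show ?thesis
      unfolding power using L0 by (simp add: algebra_simps)
  qed
  thus ?thesis
    unfolding pencil_circle_def oriented_circle.sel
    unfolding d_def[symmetric] c_def[symmetric] e_def[symmetric] r_def[symmetric] L_def[symmetric]
    by blast
qed

text \<open>A directed segment from \<open>P\<close> to \<open>Q\<close> touches the circle at a point \<open>X\<close> of the segment, where it
  is perpendicular to the radius and, if the circle carries an orientation, runs in the direction
  of that orientation. A point circle is touched when its center lies on the segment, and the
  degenerate segment with \<open>P = Q\<close> touches an unoriented circle when \<open>P\<close> lies on it.\<close>

definition segment_tangent :: "complex \<Rightarrow> complex \<Rightarrow> oriented_circle \<Rightarrow> bool" where
  "segment_tangent P Q C \<longleftrightarrow>
     (\<exists>X \<in> closed_segment P Q.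
        dist (circ_center C) X = circ_radius C \<and>
        (X - circ_center C) \<bullet> (Q - P) = 0 \<and>
        (case circ_orientation C of
           Positive \<Rightarrow> Im (cnj (X - circ_center C) * (Q - P)) > 0
         | Negative \<Rightarrow> Im (cnj (X - circ_center C) * (Q - P)) < 0
         | Unoriented \<Rightarrow> True))"

end

theory Submission
  imports Defs
begin

text \<open>In the coordinate \<open>u = g \<theta>\<close> the map \<open>\<psi>\<^sub>\<alpha>\<close> is the translation by \<open>g \<alpha>\<close> of the circle
  \<open>\<real> / 2K\<int>\<close>, so a composition is a translation again and \<open>\<gamma>\<close> is its representative in one period.
  For the tangency, the line through \<open>cis (2 * \<theta>)\<close> and \<open>cis (2 * \<theta>')\<close> has unit normal
  \<open>cis (\<theta> + \<theta>')\<close>. With \<open>v = u + a\<close>, its signed distance from the center of \<open>C\<^sub>a\<close> equals the radius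
  exactly if \<open>cn a = cn u * cn v + dn a * sn u * sn v\<close>, which is a form of the addition theorem.
  The foot of the perpendicular lies in the unit disc because \<open>C\<^sub>a\<close> does.\<close>

section \<open>Preliminaries on double angles and constant quotients\<close>

lemma cis_double_eq_iff:
  "cis (2 * x) = cis (2 * y) \<longleftrightarrow> (\<exists>m::int. x = y + of_int m * pi)"
proof -
  have "cis (2 * x) = cis (2 * y) \<longleftrightarrow> sin (2 * x) = sin (2 * y) \<and> cos (2 * x) = cos (2 * y)"
    by (auto simp: complex_eq_iff)
  also have "\<dots> \<longleftrightarrow> (\<exists>m::int. 2 * x = 2 * y + 2 * pi * of_int m)"
    by (rule sin_cos_eq_iff)
  also have "\<dots> \<longleftrightarrow> (\<exists>m::int. x = y + of_int m * pi)"
    by (intro ex_cong1) (auto simp: algebra_simps)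
  finally show ?thesis .
qed

text \<open>The last assumption says that the numerator of the derivative of \<open>N / D\<close>
  vanishes. The addition theorem is obtained by applying this along the line on which the sum of the
  two arguments is fixed.\<close>

lemma quotient_const:
  fixes N D N' D' :: "real \<Rightarrow> real"
  assumes "\<And>t. (N has_real_derivative N' t) (at t)" "\<And>t. (D has_real_derivative D' t) (at t)"
    and "\<And>t. D t \<noteq> 0" "\<And>t. N' t * D t = N t * D' t"
  shows "N x / D x = N y / D y"
proof -
  have "((\<lambda>t. N t / D t) has_real_derivative 0) (at t)" for t
    using DERIV_divide[OF assms(1,2,3)] assms(4) by simp
  then show ?thesis by (intro DERIV_isconst_all) blast
qed

section \<open>The elliptic integral and its inverse, the amplitude\<close>

locale elliptic_modulus =
  fixes k :: real
  assumes modulus: "k\<^sup>2 < 1"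
begin

lemma radicand_pos: "0 < 1 - k\<^sup>2 * (sin t)\<^sup>2"
proof -
  have "k\<^sup>2 * (sin t)\<^sup>2 \<le> k\<^sup>2 * 1"
    by (intro mult_left_mono) (simp_all add: abs_square_le_1)
  then show ?thesis using modulus by linarith
qed

lemma radicand_le_1: "1 - k\<^sup>2 * (sin t)\<^sup>2 \<le> 1"
  by simp

lemma ell_g_deriv:
  "(ell_g k has_real_derivative 1 / sqrt (1 - k\<^sup>2 * (sin x)\<^sup>2)) (at x)"
proof -
  \<comment> \<open>The interval from \<open>- B\<close> to \<open>B\<close> contains the base point
    0 and has \<open>x\<close> in its interior, so the derivative within it is the two-sided
    one.\<close>
  define B where "B = \<bar>x\<bar> + 1"
  have "((\<lambda>u. LBINT t=ereal 0..ereal u. 1 / sqrt (1 - k\<^sup>2 * (sin t)\<^sup>2)) has_vector_derivative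
      1 / sqrt (1 - k\<^sup>2 * (sin x)\<^sup>2)) (at x within {-B..B})"
  proof (rule interval_integral_FTC2)
    have "sqrt (1 - k\<^sup>2 * (sin t)\<^sup>2) \<noteq> 0" for t
      using radicand_pos[of t] by simp
    then show "continuous_on {-B..B} (\<lambda>t. 1 / sqrt (1 - k\<^sup>2 * (sin t)\<^sup>2))"
      by (intro continuous_intros) auto
  qed (auto simp: B_def)
  moreover have "at x within {-B..B} = at x"
    by (rule at_within_interior) (auto simp: B_def)
  ultimately show ?thesis
    by (simp add: has_real_derivative_iff_has_vector_derivative ell_g_def[abs_def])
qed

lemma ell_g_deriv_ge_1: "1 \<le> 1 / sqrt (1 - k\<^sup>2 * (sin x)\<^sup>2)"
  using radicand_pos[of x] radicand_le_1[of x] by simp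

lemma ell_g_0 [simp]: "ell_g k 0 = 0"
  by (simp add: ell_g_def)

text \<open>The integrand is at least 1. Growth at least as fast as the identity gives both strict
  monotonicity and, by the intermediate value theorem, surjectivity, so that \<open>am\<close> is a
  genuine inverse.\<close>

lemma ell_g_diff_ge:
  assumes "x \<le> y"
  shows "y - x \<le> ell_g k y - ell_g k x"
proof -
  have "ell_g k x - x \<le> ell_g k y - y"
  proof (rule DERIV_nonneg_imp_nondecreasing[OF assms])
    fix t
    have "((\<lambda>x. ell_g k x - x) has_real_derivative 1 / sqrt (1 - k\<^sup>2 * (sin t)\<^sup>2) - 1) (at t)"
      by (intro derivative_intros ell_g_deriv)
    then show "\<exists>D. ((\<lambda>x. ell_g k x - x) has_real_derivative D) (at t) \<and> 0 \<le> D"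
      using ell_g_deriv_ge_1[of t] by auto
  qed
  then show ?thesis by simp
qed

lemma strict_mono_ell_g: "strict_mono (ell_g k)"
proof (rule strict_monoI)
  fix x y :: real
  assume "x < y"
  then show "ell_g k x < ell_g k y" using ell_g_diff_ge[of x y] by simp
qed

lemmas ell_g_less_iff [simp] = strict_mono_less[OF strict_mono_ell_g]
lemmas ell_g_eq_iff [simp] = strict_mono_eq[OF strict_mono_ell_g]

lemma isCont_ell_g: "isCont (ell_g k) x"
  using ell_g_deriv DERIV_isCont by blast

lemma ell_g_surj: "\<exists>x. ell_g k x = y"
proof -
  have "\<exists>x\<ge>- \<bar>y\<bar>. x \<le> \<bar>y\<bar> \<and> ell_g k x = y"
    using ell_g_diff_ge[of "- \<bar>y\<bar>" 0] ell_g_diff_ge[of 0 "\<bar>y\<bar>"]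
    by (intro IVT) (auto intro: isCont_ell_g)
  then show ?thesis by blast
qed

lemma am_ell_g [simp]: "am k (ell_g k x) = x"
  unfolding am_def using strict_mono_imp_inj_on[OF strict_mono_ell_g] by (rule inv_f_f)

lemma ell_g_am [simp]: "ell_g k (am k u) = u"
  using ell_g_surj[of u] by auto

lemma am_0 [simp]: "am k 0 = 0"
  using am_ell_g[of 0] by simp

text \<open>The integrand is even, so the sum of the two sides' integrals is constant, with value 0
  at the origin.\<close>

lemma ell_g_minus [simp]: "ell_g k (- x) = - ell_g k x"
proof -
  have "((\<lambda>x. ell_g k x + ell_g k (- x)) has_real_derivative 0) (at t)" for t
    by (rule derivative_eq_intros ell_g_deriv DERIV_chain2[OF ell_g_deriv] refl)+ simp
  then have "ell_g k x + ell_g k (- x) = ell_g k 0 + ell_g k (- 0)"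
    by (intro DERIV_isconst_all) blast
  then show ?thesis by simp
qed

text \<open>The integrand has period \<open>pi\<close>, so the increment over one period is
  constant; at \<open>- (pi / 2)\<close> oddness evaluates it as \<open>2 * ell_K k\<close>.\<close>

lemma ell_g_add_pi: "ell_g k (x + pi) = ell_g k x + 2 * ell_K k"
proof -
  have "((\<lambda>x. ell_g k (x + pi) - ell_g k x) has_real_derivative 0) (at t)" for t
    by (rule derivative_eq_intros ell_g_deriv DERIV_chain2[OF ell_g_deriv] refl)+ simp
  then have "ell_g k (x + pi) - ell_g k x = ell_g k (- (pi / 2) + pi) - ell_g k (- (pi / 2))"
    by (intro DERIV_isconst_all) blast
  moreover have "- (pi / 2) + pi = pi / 2" by simp
  ultimately show ?thesis by (simp only: ell_g_minus) (simp add: ell_K_def)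
qed

lemma ell_K_pos: "0 < ell_K k"
  using ell_g_less_iff[of 0 "pi / 2"] by (simp add: ell_K_def)

lemma ell_g_add_nat_pi: "ell_g k (x + of_nat n * pi) = ell_g k x + 2 * of_nat n * ell_K k"
proof (induction n)
  case (Suc n)
  have "x + of_nat (Suc n) * pi = (x + of_nat n * pi) + pi" by (simp add: algebra_simps)
  then show ?case using Suc by (simp only: ell_g_add_pi) (simp add: algebra_simps)
qed simp

lemma ell_g_add_int_pi: "ell_g k (x + of_int m * pi) = ell_g k x + 2 * of_int m * ell_K k"
proof (cases "0 \<le> m")
  case True
  then show ?thesis using ell_g_add_nat_pi[of x "nat m"] by simp
next
  case False
  then show ?thesis using ell_g_add_nat_pi[of "x + of_int m * pi" "nat (- m)"] by simp
qed

lemma am_add_period: "am k (u + 2 * of_int m * ell_K k) = am k u + of_int m * pi"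
  by (metis am_ell_g ell_g_am ell_g_add_int_pi)

section \<open>Squares and derivatives of the Jacobi functions\<close>

lemma dn_pos: "0 < dn k u"
  using radicand_pos by (simp add: dn_def sn_def)

lemma dn_squared: "(dn k u)\<^sup>2 = 1 - k\<^sup>2 * (sn k u)\<^sup>2"
  using radicand_pos[of "am k u"] by (simp add: dn_def sn_def)

lemma cn_squared: "(cn k u)\<^sup>2 = 1 - (sn k u)\<^sup>2"
  by (simp add: cn_def sn_def cos_squared_eq)

lemma am_deriv: "(am k has_real_derivative dn k u) (at u)"
proof -
  have "isCont (am k) u"
  proof (rule isCont_inverse_function[where f = "ell_g k" and x = "am k u", simplified])
    show "\<And>z. \<bar>z - am k u\<bar> \<le> 1 \<Longrightarrow> isCont (ell_g k) z" by (rule isCont_ell_g)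
  qed auto
  then have "(am k has_real_derivative inverse (1 / sqrt (1 - k\<^sup>2 * (sin (am k u))\<^sup>2))) (at u)"
    using radicand_pos[of "am k u"]
    by (intro DERIV_inverse_function[where f = "ell_g k" and a = "u - 1" and b = "u + 1"]
        ell_g_deriv) auto
  then show ?thesis by (simp add: dn_def sn_def)
qed

lemma sn_deriv: "(sn k has_real_derivative cn k u * dn k u) (at u)"
  unfolding sn_def[abs_def] cn_def
  by (rule derivative_eq_intros am_deriv refl)+

lemma cn_deriv: "(cn k has_real_derivative - sn k u * dn k u) (at u)"
  unfolding sn_def cn_def[abs_def]
  by (rule derivative_eq_intros am_deriv refl)+

lemma dn_deriv: "(dn k has_real_derivative - k\<^sup>2 * sn k u * cn k u) (at u)"
proof -
  have "((\<lambda>u. sqrt (1 - k\<^sup>2 * (sn k u)\<^sup>2)) has_real_derivative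
      (- (k\<^sup>2 * (2 * sn k u * (cn k u * dn k u)))) * (inverse (dn k u) / 2)) (at u)"
    using dn_pos[of u]
    by (auto intro!: derivative_eq_intros sn_deriv simp: dn_def)
  moreover have "dn k = (\<lambda>u. sqrt (1 - k\<^sup>2 * (sn k u)\<^sup>2))"
    by (simp add: fun_eq_iff dn_def)
  ultimately show ?thesis
    using dn_pos[of u] by (simp add: field_simps)
qed

section \<open>The addition theorem\<close>

lemma add_denominator_pos: "0 < 1 - k\<^sup>2 * (sn k u)\<^sup>2 * (sn k v)\<^sup>2"
proof -
  have "k\<^sup>2 * (sn k u)\<^sup>2 * (sn k v)\<^sup>2 \<le> k\<^sup>2 * 1 * 1"
    by (intro mult_mono) (auto simp: sn_def abs_square_le_1)
  then show ?thesis using modulus by linarith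
qed

text \<open>With \<open>w\<close> fixed as the sum of the arguments, the second argument is
  \<open>w - t\<close>, and both sides of an addition formula become functions of \<open>t\<close>
  alone.\<close>

lemma reflected_derivs:
  "((\<lambda>t. sn k (w - t)) has_real_derivative - (cn k (w - t) * dn k (w - t))) (at t)"
  "((\<lambda>t. cn k (w - t)) has_real_derivative sn k (w - t) * dn k (w - t)) (at t)"
  "((\<lambda>t. dn k (w - t)) has_real_derivative k\<^sup>2 * sn k (w - t) * cn k (w - t)) (at t)"
proof -
  have "((\<lambda>t. w - t) has_real_derivative - 1) (at t)"
    by (auto intro!: derivative_eq_intros)
  note deriv = DERIV_chain2[OF sn_deriv this] DERIV_chain2[OF cn_deriv this]
    DERIV_chain2[OF dn_deriv this]
  show "((\<lambda>t. sn k (w - t)) has_real_derivative - (cn k (w - t) * dn k (w - t))) (at t)"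
    "((\<lambda>t. cn k (w - t)) has_real_derivative sn k (w - t) * dn k (w - t)) (at t)"
    "((\<lambda>t. dn k (w - t)) has_real_derivative k\<^sup>2 * sn k (w - t) * cn k (w - t)) (at t)"
    using deriv by simp_all
qed

lemma add_denominator_deriv:
  "((\<lambda>t. 1 - k\<^sup>2 * (sn k t)\<^sup>2 * (sn k (w - t))\<^sup>2) has_real_derivative
    2 * k\<^sup>2 * sn k t * sn k (w - t) *
      (sn k t * cn k (w - t) * dn k (w - t) - sn k (w - t) * cn k t * dn k t)) (at t)"
  by (rule derivative_eq_intros sn_deriv reflected_derivs refl)+
    (simp add: algebra_simps power2_eq_square)

lemma sn_0 [simp]: "sn k 0 = 0" and cn_0 [simp]: "cn k 0 = 1" and dn_0 [simp]: "dn k 0 = 1"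
  by (simp_all add: sn_def cn_def dn_def)

text \<open>On the line where the arguments add up to \<open>w\<close>, the quotient
  \<open>N / D\<close> of the addition formula does not depend on \<open>t\<close>, and at
  \<open>t = 0\<close> it reduces to \<open>sn k w\<close>.\<close>

lemma sn_add:
  "sn k (u + v) * (1 - k\<^sup>2 * (sn k u)\<^sup>2 * (sn k v)\<^sup>2)
    = sn k u * cn k v * dn k v + sn k v * cn k u * dn k u"
proof -
  define w where "w = u + v"
  define N where "N = (\<lambda>t. sn k t * cn k (w - t) * dn k (w - t) + sn k (w - t) * cn k t * dn k t)"
  define D where "D = (\<lambda>t. 1 - k\<^sup>2 * (sn k t)\<^sup>2 * (sn k (w - t))\<^sup>2)"
  have "N u / D u = N 0 / D 0"
  proof (rule quotient_const)
    fix t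
    note squares = cn_squared[of t] cn_squared[of "w - t"] dn_squared[of t] dn_squared[of "w - t"]
    have "(N has_real_derivative sn k t * sn k (w - t) *
        ((dn k (w - t))\<^sup>2 + k\<^sup>2 * (cn k (w - t))\<^sup>2 - (dn k t)\<^sup>2 - k\<^sup>2 * (cn k t)\<^sup>2)) (at t)"
      unfolding N_def
      by (rule derivative_eq_intros sn_deriv cn_deriv dn_deriv reflected_derivs refl)+
        (simp add: algebra_simps power2_eq_square)
    \<comment> \<open>Rewriting by \<open>squares\<close> expresses everything through
      \<open>sn\<close>: the bracket becomes twice \<open>k\<^sup>2\<close> times the difference of
      the two squared sines.\<close>
    then show "(N has_real_derivative
        2 * k\<^sup>2 * sn k t * sn k (w - t) * ((sn k t)\<^sup>2 - (sn k (w - t))\<^sup>2)) (at t)"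
      unfolding squares by (simp add: algebra_simps)
    show "(D has_real_derivative 2 * k\<^sup>2 * sn k t * sn k (w - t) *
      (sn k t * cn k (w - t) * dn k (w - t) - sn k (w - t) * cn k t * dn k t)) (at t)"
      unfolding D_def by (rule add_denominator_deriv)
    show "D t \<noteq> 0" using add_denominator_pos[of t "w - t"] by (simp add: D_def)
    \<comment> \<open>\<open>N\<close> is the sum of two terms whose difference is a factor of the
      derivative of \<open>D\<close>. The product is a difference of squares, hence a polynomial in
      the squared sines that contains \<open>D t\<close> as a factor.\<close>
    have "N t * (sn k t * cn k (w - t) * dn k (w - t) - sn k (w - t) * cn k t * dn k t)
        = (sn k t)\<^sup>2 * (cn k (w - t))\<^sup>2 * (dn k (w - t))\<^sup>2
          - (sn k (w - t))\<^sup>2 * (cn k t)\<^sup>2 * (dn k t)\<^sup>2"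
      unfolding N_def by (simp add: algebra_simps power2_eq_square)
    also have "\<dots> = ((sn k t)\<^sup>2 - (sn k (w - t))\<^sup>2) * D t"
      unfolding D_def squares by (simp add: algebra_simps)
    finally have "((sn k t)\<^sup>2 - (sn k (w - t))\<^sup>2) * D t
        = N t * (sn k t * cn k (w - t) * dn k (w - t) - sn k (w - t) * cn k t * dn k t)" ..
    then show "2 * k\<^sup>2 * sn k t * sn k (w - t) * ((sn k t)\<^sup>2 - (sn k (w - t))\<^sup>2) * D t
        = N t * (2 * k\<^sup>2 * sn k t * sn k (w - t) *
          (sn k t * cn k (w - t) * dn k (w - t) - sn k (w - t) * cn k t * dn k t))"
      by (simp add: mult_ac)
  qed
  moreover have "N 0 / D 0 = sn k w"
    by (simp add: N_def D_def)
  ultimately show ?thesis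
    using add_denominator_pos[of u v] by (simp add: N_def D_def w_def field_simps)
qed

text \<open>The method is that of \<open>sn_add\<close>; here the quotient takes the value
  \<open>cn k w\<close> at \<open>t = 0\<close>.\<close>

lemma cn_add:
  "cn k (u + v) * (1 - k\<^sup>2 * (sn k u)\<^sup>2 * (sn k v)\<^sup>2)
    = cn k u * cn k v - sn k u * sn k v * dn k u * dn k v"
proof -
  define w where "w = u + v"
  define N where "N = (\<lambda>t. cn k t * cn k (w - t) - sn k t * sn k (w - t) * dn k t * dn k (w - t))"
  define D where "D = (\<lambda>t. 1 - k\<^sup>2 * (sn k t)\<^sup>2 * (sn k (w - t))\<^sup>2)"
  have "N u / D u = N 0 / D 0"
  proof (rule quotient_const)
    fix t
    note squares = cn_squared[of t] cn_squared[of "w - t"] dn_squared[of t] dn_squared[of "w - t"]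
    have "(N has_real_derivative
        sn k t * dn k t * cn k (w - t) * ((dn k (w - t))\<^sup>2 - 1 - k\<^sup>2 * (sn k (w - t))\<^sup>2)
        + cn k t * sn k (w - t) * dn k (w - t) * (1 - (dn k t)\<^sup>2 + k\<^sup>2 * (sn k t)\<^sup>2)) (at t)"
      unfolding N_def
      by (rule derivative_eq_intros sn_deriv cn_deriv dn_deriv reflected_derivs refl)+
        (simp add: algebra_simps power2_eq_square)
    then show "(N has_real_derivative 2 * k\<^sup>2 * sn k t * sn k (w - t) *
        (sn k t * cn k t * dn k (w - t) - sn k (w - t) * cn k (w - t) * dn k t)) (at t)"
      unfolding squares by (simp add: algebra_simps power2_eq_square)
    show "(D has_real_derivative 2 * k\<^sup>2 * sn k t * sn k (w - t) *
      (sn k t * cn k (w - t) * dn k (w - t) - sn k (w - t) * cn k t * dn k t)) (at t)"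
      unfolding D_def by (rule add_denominator_deriv)
    show "D t \<noteq> 0" using add_denominator_pos[of t "w - t"] by (simp add: D_def)
    \<comment> \<open>The product is grouped so that both inner brackets, of the shape
      \<open>cn\<^sup>2 + sn\<^sup>2 * dn\<^sup>2\<close> with \<open>dn\<close> at the other
      argument, equal \<open>D t\<close>.\<close>
    have "N t * (sn k t * cn k (w - t) * dn k (w - t) - sn k (w - t) * cn k t * dn k t)
        = sn k t * cn k t * dn k (w - t) * ((cn k (w - t))\<^sup>2 + (sn k (w - t))\<^sup>2 * (dn k t)\<^sup>2)
          - sn k (w - t) * cn k (w - t) * dn k t * ((cn k t)\<^sup>2 + (sn k t)\<^sup>2 * (dn k (w - t))\<^sup>2)"
      unfolding N_def by (simp add: algebra_simps power2_eq_square)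
    also have "\<dots> = (sn k t * cn k t * dn k (w - t) - sn k (w - t) * cn k (w - t) * dn k t) * D t"
      unfolding D_def squares by (simp add: algebra_simps)
    finally have "(sn k t * cn k t * dn k (w - t) - sn k (w - t) * cn k (w - t) * dn k t) * D t
        = N t * (sn k t * cn k (w - t) * dn k (w - t) - sn k (w - t) * cn k t * dn k t)" ..
    then show "2 * k\<^sup>2 * sn k t * sn k (w - t) *
          (sn k t * cn k t * dn k (w - t) - sn k (w - t) * cn k (w - t) * dn k t) * D t
        = N t * (2 * k\<^sup>2 * sn k t * sn k (w - t) *
          (sn k t * cn k (w - t) * dn k (w - t) - sn k (w - t) * cn k t * dn k t))"
      by (simp add: mult_ac)
  qed
  moreover have "N 0 / D 0 = cn k w"
    by (simp add: N_def D_def)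
  ultimately show ?thesis
    using add_denominator_pos[of u v] by (simp add: N_def D_def w_def field_simps)
qed

text \<open>After inserting \<open>cn_add\<close> and \<open>sn_add\<close>, the two terms
  containing \<open>sn k a\<close> as a linear factor cancel. What remains is \<open>cn k a\<close>
  times a bracket equal to the common denominator.\<close>

lemma cn_translation:
  "cn k u * cn k (u + a) + dn k a * sn k u * sn k (u + a) = cn k a"
proof -
  define D where "D = 1 - k\<^sup>2 * (sn k u)\<^sup>2 * (sn k a)\<^sup>2"
  have "(cn k u * cn k (u + a) + dn k a * sn k u * sn k (u + a)) * D
      = cn k u * (cn k (u + a) * D) + dn k a * sn k u * (sn k (u + a) * D)"
    by (simp add: algebra_simps)
  also have "\<dots> = cn k a * ((cn k u)\<^sup>2 + (sn k u)\<^sup>2 * (dn k a)\<^sup>2)"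
    unfolding D_def cn_add sn_add by (simp add: algebra_simps power2_eq_square)
  also have "\<dots> = cn k a * D"
    unfolding D_def cn_squared dn_squared by (simp add: algebra_simps)
  finally show ?thesis
    using add_denominator_pos[of u a] by (simp add: D_def)
qed

section \<open>The maps \<open>psi\<close> as translations\<close>

lemma psi_cis: "psi k \<alpha> (cis (2 * \<theta>)) = cis (2 * am k (ell_g k \<theta> + ell_g k \<alpha>))"
proof -
  define \<eta> where "\<eta> = (SOME \<eta>. cis (2 * \<theta>) = cis (2 * \<eta>))"
  have "cis (2 * \<theta>) = cis (2 * \<eta>)"
    unfolding \<eta>_def by (rule someI[of _ \<theta>]) simp
  then obtain m :: int where "\<theta> = \<eta> + of_int m * pi"
    unfolding cis_double_eq_iff by blast
  \<comment> \<open>The angle picked by \<open>SOME\<close> is off by \<open>m\<close> half-turns.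
    This shifts the elliptic coordinate by \<open>m\<close> periods and the resulting amplitude by
    \<open>m * pi\<close>, which the doubled angle does not see.\<close>
  then have eq: "ell_g k \<theta> + ell_g k \<alpha> = (ell_g k \<eta> + ell_g k \<alpha>) + 2 * of_int m * ell_K k"
    by (simp add: ell_g_add_int_pi)
  have "cis (2 * am k (ell_g k \<theta> + ell_g k \<alpha>)) = cis (2 * am k (ell_g k \<eta> + ell_g k \<alpha>))"
    unfolding cis_double_eq_iff eq am_add_period by blast
  then show ?thesis
    by (simp add: psi_def Let_def \<eta>_def)
qed

lemma psi_comp_cis:
  "psi_comp k \<alpha> n (cis (2 * \<theta>)) = cis (2 * am k (ell_g k \<theta> + (\<Sum>j=1..n. ell_g k (\<alpha> j))))"
proof (induction n)
  case (Suc n)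
  then show ?case by (simp add: psi_cis add.assoc)
qed simp

section \<open>Tangency of the chord to the pencil circle\<close>

lemma cn_le_dn: "cn k u \<le> dn k u"
proof (rule power2_le_imp_le)
  have "k\<^sup>2 * (sn k u)\<^sup>2 \<le> 1 * (sn k u)\<^sup>2"
    using modulus by (intro mult_right_mono) auto
  then show "(cn k u)\<^sup>2 \<le> (dn k u)\<^sup>2" by (simp add: cn_squared dn_squared)
qed (use dn_pos[of u] in simp)

text \<open>Rotating by \<open>- \<phi>\<close> turns the endpoints into
  \<open>cis (- \<delta>)\<close> and \<open>cis \<delta>\<close>, so the chord becomes vertical
  with abscissa \<open>cos \<delta>\<close>. The contact point \<open>X\<close> is the end of the
  radius in direction \<open>\<phi>\<close>: \<open>dist_r\<close> puts it on the line of the chord,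
  and its lying in the unit disc puts it between the endpoints.\<close>

lemma segment_tangent_chord:
  assumes \<gamma>: "- (pi / 2) < \<gamma>" "\<gamma> \<le> pi / 2"
  shows "segment_tangent (cis (2 * \<theta>)) (cis (2 * am k (ell_g k \<theta> + ell_g k \<gamma>)))
    (pencil_circle k (ell_g k \<gamma>))"
proof -
  define a where "a = ell_g k \<gamma>"
  define \<theta>' where "\<theta>' = am k (ell_g k \<theta> + a)"
  define c where "c = (dn k a - 1) / (dn k a + 1)"
  define r where "r = 2 * cn k a / (1 + dn k a)"
  define \<phi> where "\<phi> = \<theta> + \<theta>'"
  define \<delta> where "\<delta> = \<theta>' - \<theta>"
  define X where "X = complex_of_real c + of_real r * cis \<phi>"
  define P where "P = cis (2 * \<theta>)"
  define Q where "Q = cis (2 * \<theta>')"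
  have P: "P = cis (\<phi> - \<delta>)" and Q: "Q = cis (\<phi> + \<delta>)"
    by (simp_all add: P_def Q_def \<phi>_def \<delta>_def)
  have QP: "Q - P = of_real (2 * sin \<delta>) * \<i> * cis \<phi>"
    unfolding P Q by (simp add: complex_eq_iff cos_add cos_diff sin_add sin_diff)
  have d0: "0 < dn k a" by (rule dn_pos)
  have cn0: "0 \<le> cn k a"
    unfolding cn_def a_def using \<gamma> by (simp add: cos_ge_zero)
  then have r0: "0 \<le> r" using d0 by (simp add: r_def)
  have dist_r: "c * cos \<phi> + r = cos \<delta>"
  proof -
    have "cos \<theta> * cos \<theta>' + dn k a * sin \<theta> * sin \<theta>' = cn k a"
      using cn_translation[of "ell_g k \<theta>" a] by (simp add: sn_def[of _ "_ + _"] cn_def[of _ "_ + _"]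
        \<theta>'_def[symmetric] sn_def[of _ "ell_g k \<theta>"] cn_def[of _ "ell_g k \<theta>"])
    \<comment> \<open>Doubling and expanding the products into cosines of the sum
      \<open>\<phi>\<close> and the difference \<open>\<delta>\<close>.\<close>
    then have "(dn k a - 1) * cos \<phi> + 2 * cn k a = (dn k a + 1) * cos \<delta>"
      by (simp add: \<phi>_def \<delta>_def cos_add cos_diff algebra_simps)
    moreover have "c * cos \<phi> + r = ((dn k a - 1) * cos \<phi> + 2 * cn k a) / (dn k a + 1)"
      by (simp add: c_def r_def add_divide_distrib add.commute)
    ultimately show ?thesis using d0 by simp
  qed
  have X: "X = (of_real (cos \<delta>) - \<i> * of_real (c * sin \<phi>)) * cis \<phi>"
  proof -
    have "X = (of_real c * cis (- \<phi>) + of_real r) * cis \<phi>"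
      by (simp add: X_def ring_distribs mult.assoc cis_mult)
    also have "of_real c * cis (- \<phi>) + of_real r = of_real (cos \<delta>) - \<i> * of_real (c * sin \<phi>)"
      using dist_r by (simp add: complex_eq_iff)
    finally show ?thesis .
  qed
  have "dn k a \<le> 1"
    using radicand_le_1[of "am k a"] by (simp add: dn_def sn_def)
  then have "\<bar>c\<bar> + r = (1 - dn k a + 2 * cn k a) / (1 + dn k a)"
    using d0 by (simp add: c_def r_def abs_divide add_divide_distrib add.commute)
  \<comment> \<open>Clearing the denominator leaves exactly \<open>cn k a \<le> dn k a\<close>; this
    places the pencil circle in the closed unit disc.\<close>
  also have "\<dots> \<le> 1" using d0 cn_le_dn[of a] by simp
  finally have "\<bar>c\<bar> + r \<le> 1" .
  moreover have "cmod X \<le> \<bar>c\<bar> + r"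
    unfolding X_def using norm_triangle_ineq[of "of_real c" "of_real r * cis \<phi>"] r0
    by (simp add: norm_mult)
  ultimately have "(cmod X)\<^sup>2 \<le> 1" by (simp add: abs_square_le_1)
  moreover have "(cmod X)\<^sup>2 = (cos \<delta>)\<^sup>2 + (c * sin \<phi>)\<^sup>2"
    unfolding X norm_mult by (simp add: cmod_power2)
  ultimately have "(c * sin \<phi>)\<^sup>2 \<le> (sin \<delta>)\<^sup>2" by (simp add: cos_squared_eq)
  then have le: "\<bar>c * sin \<phi>\<bar> \<le> \<bar>sin \<delta>\<bar>" by (simp only: abs_le_square_iff)
  \<comment> \<open>In the rotated frame \<open>X\<close> has height
    \<open>- c * sin \<phi>\<close>, while the chord point with parameter \<open>t\<close> has
    height \<open>(2 * t - 1) * sin \<delta>\<close>; equating them gives \<open>t\<close>. If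
    \<open>sin \<delta> = 0\<close>, division yields \<open>q = 0\<close>, and \<open>le\<close>
    forces \<open>c * sin \<phi> = 0\<close>, so the equation still holds.\<close>
  define q where "q = c * sin \<phi> / sin \<delta>"
  define t where "t = (1 - q) / 2"
  have "\<bar>q\<bar> \<le> 1"
    unfolding q_def abs_divide by (rule divide_le_eq_1[THEN iffD2]) (use le in auto)
  then have t: "0 \<le> t" "t \<le> 1" by (simp_all add: t_def abs_le_iff)
  have "q * sin \<delta> = c * sin \<phi>"
    using le by (cases "sin \<delta> = 0") (simp_all add: q_def)
  moreover have "2 * t - 1 = - q" by (simp add: t_def field_simps)
  ultimately have "(2 * t - 1) * sin \<delta> = - (c * sin \<phi>)" by simp
  then have "X = (of_real (cos \<delta>) + \<i> * of_real ((2 * t - 1) * sin \<delta>)) * cis \<phi>"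
    unfolding X by simp
  also have "\<dots> = cis (- \<delta>) * cis \<phi> + of_real t * (of_real (2 * sin \<delta>) * \<i> * cis \<phi>)"
    by (simp add: complex_eq_iff algebra_simps)
  also have "\<dots> = P + of_real t * (Q - P)"
    unfolding QP by (simp add: P cis_mult)
  finally have "X = (1 - t) *\<^sub>R P + t *\<^sub>R Q"
    by (simp add: scaleR_conv_of_real algebra_simps)
  then have seg: "X \<in> closed_segment P Q"
    using t unfolding closed_segment_def by blast
  \<comment> \<open>Its zero real part is the orthogonality of radius and chord, and the sign of its
    imaginary part is the direction of travel.\<close>
  have perp: "cnj (X - of_real c) * (Q - P) = of_real (2 * r * sin \<delta>) * \<i>"
    unfolding X_def QP by (simp add: cis_cnj cis_mult mult_ac)
  have inner: "(X - of_real c) \<bullet> (Q - P) = 0"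
  proof -
    have "(X - of_real c) \<bullet> (Q - P) = Re (cnj (X - of_real c) * (Q - P))"
      by (simp add: inner_complex_def)
    then show ?thesis unfolding perp by simp
  qed
  have dist: "dist (of_real c) X = r"
    using r0 by (simp add: X_def dist_norm norm_mult)
  have K: "ell_g k (\<theta> + pi) = ell_g k \<theta> + 2 * ell_K k"
          "ell_g k (\<theta> - pi) = ell_g k \<theta> - 2 * ell_K k"
    using ell_g_add_pi[of \<theta>] ell_g_add_pi[of "\<theta> - pi"] by simp_all
  have g\<theta>': "ell_g k \<theta>' = ell_g k \<theta> + a" by (simp add: \<theta>'_def)
  have rpos: "0 < r" if "\<gamma> \<noteq> pi / 2"
    using that \<gamma> d0 by (simp add: r_def a_def cn_def cos_gt_zero_pi)
  have a_K: "a = ell_K k \<longleftrightarrow> \<gamma> = pi / 2" by (simp add: a_def ell_K_def)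
  have a_le: "a \<le> ell_K k" "- ell_K k < a"
    using \<gamma> strict_mono_less_eq[OF strict_mono_ell_g, of \<gamma> "pi / 2"]
      ell_g_less_iff[of "- (pi / 2)" \<gamma>] by (simp_all add: a_def ell_K_def)
  \<comment> \<open>A positive shift smaller than the period \<open>2 * ell_K k\<close> moves the
    angle forward by less than \<open>pi\<close>. A negative one moves it backward in the same way,
    so the sign of \<open>a\<close> is the orientation.\<close>
  have pos: "0 < r * sin \<delta>" if "0 < a" "\<gamma> \<noteq> pi / 2"
  proof -
    have "ell_g k \<theta> < ell_g k \<theta>'" "ell_g k \<theta>' < ell_g k (\<theta> + pi)"
      unfolding g\<theta>' K using that a_le ell_K_pos by linarith+
    then have "\<theta> < \<theta>'" "\<theta>' < \<theta> + pi" by simp_all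
    then have "0 < sin \<delta>" unfolding \<delta>_def by (intro sin_gt_zero) auto
    then show ?thesis using rpos that by simp
  qed
  have neg: "r * sin \<delta> < 0" if "a < 0" "\<gamma> \<noteq> pi / 2"
  proof -
    have "ell_g k \<theta>' < ell_g k \<theta>" "ell_g k (\<theta> - pi) < ell_g k \<theta>'"
      unfolding g\<theta>' K using that a_le ell_K_pos by linarith+
    then have "\<theta>' < \<theta>" "\<theta> - pi < \<theta>'" by simp_all
    then have "0 < sin (- \<delta>)" unfolding \<delta>_def by (intro sin_gt_zero) auto
    then show ?thesis using rpos that by (simp add: mult_pos_neg)
  qed
  have "segment_tangent P Q (pencil_circle k a)"
    unfolding segment_tangent_def
  proof (intro bexI[OF _ seg] conjI)
    show "dist (circ_center (pencil_circle k a)) X = circ_radius (pencil_circle k a)"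
      using dist by (simp add: pencil_circle_def c_def r_def)
    show "(X - circ_center (pencil_circle k a)) \<bullet> (Q - P) = 0"
      using inner by (simp add: pencil_circle_def c_def)
    have center: "circ_center (pencil_circle k a) = of_real c"
      by (simp add: pencil_circle_def c_def)
    have Im: "Im (cnj (X - of_real c) * (Q - P)) = 2 * (r * sin \<delta>)"
      unfolding perp by simp
    show "case circ_orientation (pencil_circle k a) of
        Positive \<Rightarrow> 0 < Im (cnj (X - circ_center (pencil_circle k a)) * (Q - P))
      | Negative \<Rightarrow> Im (cnj (X - circ_center (pencil_circle k a)) * (Q - P)) < 0
      | Unoriented \<Rightarrow> True"
      unfolding center Im using pos neg a_K by (auto simp: pencil_circle_def)
  qed
  then show ?thesis by (simp add: P_def Q_def \<theta>'_def a_def)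
qed

section \<open>Existence and uniqueness of the resulting parameter\<close>

lemma ell_g_period_representative:
  "\<exists>\<gamma> (m::int). - (pi / 2) < \<gamma> \<and> \<gamma> \<le> pi / 2 \<and> S = ell_g k \<gamma> + 2 * of_int m * ell_K k"
proof -
  \<comment> \<open>\<open>m\<close> is the least integer that brings \<open>am k S - m * pi\<close>
    down to at most \<open>pi / 2\<close>. The right endpoint belongs to the interval because
    translations by less than \<open>ell_K k\<close> can add up to \<open>ell_K k\<close> itself,
    for instance two by half of it.\<close>
  define m where "m = \<lceil>am k S / pi - 1 / 2\<rceil>"
  define \<gamma> where "\<gamma> = am k S - of_int m * pi"
  have "am k S / pi - 1 / 2 \<le> of_int m" "of_int m < am k S / pi - 1 / 2 + 1"
    unfolding m_def using ceiling_correct[of "am k S / pi - 1 / 2"] by linarith+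
  then have "- (pi / 2) < \<gamma>" "\<gamma> \<le> pi / 2"
    unfolding \<gamma>_def by (simp_all add: field_simps)
  moreover have "S = ell_g k \<gamma> + 2 * of_int m * ell_K k"
    using ell_g_add_int_pi[of \<gamma> m] by (simp add: \<gamma>_def)
  ultimately show ?thesis by blast
qed

text \<open>The value of \<open>psi k \<gamma>\<close> at 1 is \<open>cis (2 * \<gamma>)\<close>,
  which determines the parameter modulo \<open>pi\<close>, and a half-open interval of length
  \<open>pi\<close> contains only one representative.\<close>

lemma psi_eq_imp_eq:
  assumes "- (pi / 2) < \<gamma>" "\<gamma> \<le> pi / 2" "- (pi / 2) < \<gamma>'" "\<gamma>' \<le> pi / 2"
    and "psi k \<gamma> 1 = psi k \<gamma>' 1"
  shows "\<gamma> = \<gamma>'"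
proof -
  have "cis (2 * \<gamma>) = cis (2 * \<gamma>')"
    using assms(5) psi_cis[of _ 0] by simp
  then obtain m :: int where m: "\<gamma> = \<gamma>' + of_int m * pi"
    unfolding cis_double_eq_iff by blast
  then have "\<bar>of_int m * pi\<bar> < 1 * pi" using assms by linarith
  then have "\<bar>of_int m :: real\<bar> < 1"
    unfolding abs_mult by simp
  then show ?thesis using m by simp
qed

end

lemma unit_circle_cis_double:
  assumes "z \<in> unit_circle"
  shows "\<exists>\<theta>. z = cis (2 * \<theta>)"
proof -
  have "z = cis (2 * (Arg z / 2))"
    using assms cis_Arg[of z] by (cases "z = 0") (auto simp: sgn_div_norm)
  then show ?thesis ..
qed

theorem theorem7:
  fixes k k' :: real and n :: nat and \<alpha> :: "nat \<Rightarrow> real"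
  assumes "0 < k'" and "k' < 1" and "k = sqrt (1 - k'\<^sup>2)"
    and "1 \<le> n"
    and "\<And>j. j \<in> {1..n} \<Longrightarrow> \<alpha> j \<in> {- (pi / 2) <..< pi / 2}"
  shows "(\<exists>!\<gamma>. \<gamma> \<in> {- (pi / 2) <.. pi / 2} \<and>
             (\<forall>z \<in> unit_circle. psi_comp k \<alpha> n z = psi k \<gamma> z)) \<and>
         (\<forall>\<gamma>. \<gamma> \<in> {- (pi / 2) <.. pi / 2} \<and>
             (\<forall>z \<in> unit_circle. psi_comp k \<alpha> n z = psi k \<gamma> z) \<longrightarrow>
             (\<forall>P :: nat \<Rightarrow> complex. P 0 \<in> unit_circle \<and>
                (\<forall>j \<in> {1..n}. P j = psi k (\<alpha> j) (P (j - 1))) \<longrightarrow>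
                segment_tangent (P 0) (P n) (pencil_circle k (ell_g k \<gamma>))))"
proof (intro conjI allI impI)
  have "k'\<^sup>2 < 1" using assms by (simp add: power_less_one_iff)
  then have "k\<^sup>2 < 1" using assms by simp
  then interpret elliptic_modulus k by unfold_locales
  show "\<exists>!\<gamma>. \<gamma> \<in> {- (pi / 2) <.. pi / 2} \<and>
      (\<forall>z \<in> unit_circle. psi_comp k \<alpha> n z = psi k \<gamma> z)"
  proof (rule ex_ex1I)
    obtain \<gamma> and m :: int where \<gamma>: "- (pi / 2) < \<gamma>" "\<gamma> \<le> pi / 2"
      and S: "(\<Sum>j=1..n. ell_g k (\<alpha> j)) = ell_g k \<gamma> + 2 * of_int m * ell_K k"
      using ell_g_period_representative by blast
    have "psi_comp k \<alpha> n (cis (2 * \<theta>)) = psi k \<gamma> (cis (2 * \<theta>))" for \<theta>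
      unfolding psi_comp_cis psi_cis S cis_double_eq_iff
      by (rule exI[of _ m]) (simp flip: am_add_period add.assoc)
    then have "\<forall>z \<in> unit_circle. psi_comp k \<alpha> n z = psi k \<gamma> z"
      using unit_circle_cis_double by metis
    then show "\<exists>\<gamma>. \<gamma> \<in> {- (pi / 2) <.. pi / 2} \<and>
        (\<forall>z \<in> unit_circle. psi_comp k \<alpha> n z = psi k \<gamma> z)"
      using \<gamma> by auto
  next
    fix \<gamma> \<gamma>'
    assume "\<gamma> \<in> {- (pi / 2) <.. pi / 2} \<and> (\<forall>z \<in> unit_circle. psi_comp k \<alpha> n z = psi k \<gamma> z)"
      and "\<gamma>' \<in> {- (pi / 2) <.. pi / 2} \<and> (\<forall>z \<in> unit_circle. psi_comp k \<alpha> n z = psi k \<gamma>' z)"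
    moreover from this have "psi k \<gamma> 1 = psi k \<gamma>' 1"
      by (metis dist_0_norm mem_sphere norm_one)
    ultimately show "\<gamma> = \<gamma>'"
      by (intro psi_eq_imp_eq) auto
  qed
  fix \<gamma> and P :: "nat \<Rightarrow> complex"
  assume \<gamma>: "\<gamma> \<in> {- (pi / 2) <.. pi / 2} \<and>
      (\<forall>z \<in> unit_circle. psi_comp k \<alpha> n z = psi k \<gamma> z)"
    and P: "P 0 \<in> unit_circle \<and> (\<forall>j \<in> {1..n}. P j = psi k (\<alpha> j) (P (j - 1)))"
  \<comment> \<open>The recursion for \<open>P\<close> is given only up to index \<open>n\<close>,
    hence the guard in the induction.\<close>
  have "i \<le> n \<Longrightarrow> P i = psi_comp k \<alpha> i (P 0)" for i
    by (induction i) (use P in auto)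
  then have "P n = psi_comp k \<alpha> n (P 0)" by blast
  also have "\<dots> = psi k \<gamma> (P 0)" using \<gamma> P by blast
  finally have Pn: "P n = psi k \<gamma> (P 0)" .
  obtain \<theta> where P0: "P 0 = cis (2 * \<theta>)"
    using P unit_circle_cis_double by blast
  show "segment_tangent (P 0) (P n) (pencil_circle k (ell_g k \<gamma>))"
    unfolding Pn unfolding P0 psi_cis using \<gamma> by (intro segment_tangent_chord) simp_all
qed

end
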